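(* Let $n\ge 2$ and let $(G,f)=der_{\theta,b}(G,\cdot)$ be an $n$-ary group. Then $(G,f)$ is universal algebraically simple (UAS) if and only if the only $\theta$-invariant normal subgroups of the group $(G,\cdot)$ are the trivial subgroups $\{e\}$ and $G$.
   Context: Setting: $(G,\cdot)$ is a group with identity $e$, $\theta$ is an automorphism of $(G,\cdot)$, $b\in G$ satisfies $\theta(b)=b$ and $\theta^{n-1}(x)=bxb^{-1}$ for all $x\in G$, and $f:G^n\to G$ is defined by $f(x_1,\ldots,x_n)=x_1\theta(x_2)\theta^2(x_3)\cdots\theta^{n-1}(x_n)b$. The pair $(G,f)$ is then an $n$-ary (polyadic) group, denoted $der_{\theta,b}(G,\cdot)$ (every $n$-ary group has this form). For $x\in G$, the skew element $\overline{x}$ is the unique element $y\in G$ with $f(x,\ldots,x,y)=x$ ($n-1$ copies of $x$ before $y$). A congruence of $(G,f)$ is an equivalence relation $R$ on $G$ such that (1) if $x_iRy_i$ for $i=1,\ldots,n$ then $f(x_1,\ldots,x_n)\,R\,f(y_1,\ldots,y_n)$; (2) $xRy$ implies $\overline{x}R\overline{y}$. The $n$-ary group $(G,f)$ is universal algebraically simple (UAS) if every congruence $R$ of $(G,f)$ is either the equality relation $\Delta=\{(x,x):x\in G\}$ or $G\times G$. A subgroup $H$ is $\theta$-invariant if $\theta(H)\subseteq H$. *)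

theory Defs
  imports "HOL-Algebra.Algebra"
begin

text \<open>
  An \<open>n\<close>-ary operation on a carrier \<open>A\<close> is a function on lists; only its values on lists of
  length \<open>n\<close> with entries in \<open>A\<close> matter. The list index is zero-based, so the entry \<open>xs ! i\<close> is
  the argument \<open>x\<^sub>i\<^sub>+\<^sub>1\<close> of the informal notation.
\<close>

text \<open>
  The product below unfolds to
  \<open>x\<^sub>1 \<otimes> (\<theta> x\<^sub>2 \<otimes> (\<theta>\<^sup>2 x\<^sub>3 \<otimes> (\<dots> \<otimes> (\<theta>\<^sup>n\<^sup>-\<^sup>1 x\<^sub>n \<otimes> b))))\<close>.
\<close>

definition der_op ::
    "('a, 'm) monoid_scheme \<Rightarrow> nat \<Rightarrow> ('a \<Rightarrow> 'a) \<Rightarrow> 'a \<Rightarrow> 'a list \<Rightarrow> 'a" where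
  "der_op G n \<theta> b xs =
     foldr (\<lambda>x y. x \<otimes>\<^bsub>G\<^esub> y) (map (\<lambda>i. (\<theta> ^^ i) (xs ! i)) [0..<n]) b"

text \<open>
  The description operator is meaningful whenever \<open>(A, f)\<close> is an \<open>n\<close>-ary group, where the
  defining equation has exactly one solution in \<open>A\<close>.
\<close>

definition skew :: "'a set \<Rightarrow> nat \<Rightarrow> ('a list \<Rightarrow> 'a) \<Rightarrow> 'a \<Rightarrow> 'a" where
  "skew A n f x = (THE y. y \<in> A \<and> f (replicate (n - 1) x @ [y]) = x)"

definition nary_congruence ::
    "'a set \<Rightarrow> nat \<Rightarrow> ('a list \<Rightarrow> 'a) \<Rightarrow> ('a \<times> 'a) set \<Rightarrow> bool" where
  "nary_congruence A n f R \<longleftrightarrow>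
     equiv A R \<and>
     (\<forall>xs ys. length xs = n \<longrightarrow> length ys = n \<longrightarrow>
        (\<forall>i<n. (xs ! i, ys ! i) \<in> R) \<longrightarrow> (f xs, f ys) \<in> R) \<and>
     (\<forall>x y. (x, y) \<in> R \<longrightarrow> (skew A n f x, skew A n f y) \<in> R)"

definition UAS :: "'a set \<Rightarrow> nat \<Rightarrow> ('a list \<Rightarrow> 'a) \<Rightarrow> bool" where
  "UAS A n f \<longleftrightarrow> (\<forall>R. nary_congruence A n f R \<longrightarrow> R = Id_on A \<or> R = A \<times> A)"

end

theory Submission imports Defs begin

text \<open>
  Fixing all but one argument of \<open>f\<close> suitably turns \<open>f\<close> into any left or right translation of
  the group, via \<open>f (x, e, \<dots>, e, z) = x b z\<close>, or into \<open>x \<mapsto> \<theta> x \<cdot> b\<close>, via \<open>f (e, x, e, \<dots>, e)\<close>.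
  Hence the congruences of \<open>(G, f)\<close> are exactly the congruences of the group compatible with \<open>\<theta>\<close>,
  that is, the coset relations of the \<open>\<theta>\<close>-invariant normal subgroups.
\<close>

context group
begin

section \<open>Products of lists in a group\<close>

lemma foldr_mult_closed:
  assumes "set xs \<subseteq> carrier G" "c \<in> carrier G"
  shows "foldr (\<otimes>) xs c \<in> carrier G"
  using assms by (induction xs) auto

lemma foldr_mult_eq_mult:
  assumes "set xs \<subseteq> carrier G" "c \<in> carrier G"
  shows "foldr (\<otimes>) xs c = foldr (\<otimes>) xs \<one> \<otimes> c"
  using assms by (induction xs) (auto simp: m_assoc foldr_mult_closed)

lemma foldr_mult_ones:
  assumes "set xs \<subseteq> {\<one>}" "c \<in> carrier G"
  shows "foldr (\<otimes>) xs c = c"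
  using assms by (induction xs) auto

text \<open>Serves both clauses of a congruence: the operation and the skew element are each built
  from such a product, seeded with \<open>b\<close>.\<close>

lemma foldr_mult_list_all2:
  assumes mult: "\<And>x y u v. (x, y) \<in> R \<Longrightarrow> (u, v) \<in> R \<Longrightarrow> (x \<otimes> u, y \<otimes> v) \<in> R"
    and "list_all2 (\<lambda>x y. (x, y) \<in> R) xs ys" "(c, d) \<in> R"
  shows "(foldr (\<otimes>) xs c, foldr (\<otimes>) ys d) \<in> R"
  using assms(2,3) by (induction rule: list_all2_induct) (auto intro: mult)

section \<open>Congruence modulo a normal subgroup\<close>

lemma rcong_mult:
  assumes "H \<lhd> G" "(x, y) \<in> rcong H" "(u, v) \<in> rcong H"
  shows "(x \<otimes> u, y \<otimes> v) \<in> rcong H"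
proof -
  interpret normal H G by fact
  have c: "x \<in> carrier G" "y \<in> carrier G" "u \<in> carrier G" "v \<in> carrier G"
    and H: "inv x \<otimes> y \<in> H" "inv u \<otimes> v \<in> H"
    using assms(2,3) by (auto simp: r_congruent_def)
  \<comment> \<open>Inserting \<open>u \<otimes> inv u\<close> before \<open>v\<close> leaves a
    conjugate of \<open>inv x \<otimes> y\<close>, which normality keeps in
    \<open>H\<close>.\<close>
  have "inv (x \<otimes> u) \<otimes> (y \<otimes> v) = (inv u \<otimes> (inv x \<otimes> y) \<otimes> u) \<otimes> (inv u \<otimes> v)"
    using c by (simp add: m_assoc inv_mult_group flip: m_assoc[of u "inv u"])
  moreover have "inv u \<otimes> (inv x \<otimes> y) \<otimes> u \<in> H"
    using c H inv_op_closed1 by blast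
  ultimately show ?thesis using c H by (simp add: r_congruent_def)
qed

lemma rcong_inv:
  assumes "H \<lhd> G" "(x, y) \<in> rcong H"
  shows "(inv x, inv y) \<in> rcong H"
proof -
  interpret normal H G by fact
  have c: "x \<in> carrier G" "y \<in> carrier G" and H: "inv x \<otimes> y \<in> H"
    using assms(2) by (auto simp: r_congruent_def)
  \<comment> \<open>With \<open>h = inv x \<otimes> y\<close> we have
    \<open>x = y \<otimes> inv h\<close>, so the required quotient is a conjugate of
    \<open>inv h\<close>.\<close>
  have "x \<otimes> inv y = y \<otimes> inv (inv x \<otimes> y) \<otimes> inv y"
    using c by (simp add: m_assoc inv_mult_group flip: m_assoc[of y "inv y"])
  also have "\<dots> \<in> H" using c H inv_op_closed2 by simp
  finally show ?thesis using c by (simp add: r_congruent_def)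
qed

text \<open>Left translations make the class of \<open>\<one>\<close> a subgroup and reduce
  \<open>(x, y)\<close> to \<open>(\<one>, inv x \<otimes> y)\<close>; adding right translations
  gives conjugations, hence normality.\<close>

lemma normal_of_translation_invariant:
  assumes eq: "equiv (carrier G) R"
    and left: "\<And>g x y. g \<in> carrier G \<Longrightarrow> (x, y) \<in> R \<Longrightarrow> (g \<otimes> x, g \<otimes> y) \<in> R"
    and right: "\<And>g x y. g \<in> carrier G \<Longrightarrow> (x, y) \<in> R \<Longrightarrow> (x \<otimes> g, y \<otimes> g) \<in> R"
  shows "R `` {\<one>} \<lhd> G"
    and "R = rcong (R `` {\<one>})"
proof -
  have carr: "x \<in> carrier G \<and> y \<in> carrier G" if "(x, y) \<in> R" for x y
    using eq that by (auto simp: equiv_def)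
  have refl: "(x, x) \<in> R" if "x \<in> carrier G" for x
    using eq that by (auto simp: equiv_def refl_on_def)
  have sym: "(y, x) \<in> R" if "(x, y) \<in> R" for x y
    using eq that by (auto simp: equiv_def dest: symD)
  have trans: "(x, z) \<in> R" if "(x, y) \<in> R" "(y, z) \<in> R" for x y z
    using eq that by (auto simp: equiv_def dest: transD)
  have "subgroup (R `` {\<one>}) G"
  proof (unfold_locales)
    show "R `` {\<one>} \<subseteq> carrier G" using carr by auto
    show "\<one> \<in> R `` {\<one>}" using refl by auto
    fix x assume x: "x \<in> R `` {\<one>}"
    then show "inv x \<in> R `` {\<one>}"
      using left[of "inv x" x \<one>] sym carr by force
    fix y assume "y \<in> R `` {\<one>}"
    then show "x \<otimes> y \<in> R `` {\<one>}"
      using left[of x \<one> y] x trans carr by force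
  qed
  \<comment> \<open>From \<open>(\<one>, h)\<close> to \<open>(g, g \<otimes> h)\<close> on the
    left, then to \<open>(\<one>, g \<otimes> h \<otimes> inv g)\<close> on the right.\<close>
  moreover have "g \<otimes> h \<otimes> inv g \<in> R `` {\<one>}" if "g \<in> carrier G" "h \<in> R `` {\<one>}" for g h
    using that right[of "inv g" "g \<otimes> \<one>" "g \<otimes> h"] left[of g \<one> h] by auto
  ultimately show "R `` {\<one>} \<lhd> G" by (simp add: normal_inv_iff)
  show "R = rcong (R `` {\<one>})"
  proof (intro equalityI subrelI)
    fix x y assume "(x, y) \<in> R"
    then show "(x, y) \<in> rcong (R `` {\<one>})"
      using left[of "inv x" x y] carr by (force simp: r_congruent_def)
  next
    fix x y assume "(x, y) \<in> rcong (R `` {\<one>})"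
    then have c: "x \<in> carrier G" "y \<in> carrier G" and "(\<one>, inv x \<otimes> y) \<in> R"
      by (auto simp: r_congruent_def)
    then show "(x, y) \<in> R" using left[of x \<one> "inv x \<otimes> y"]
      by (simp flip: m_assoc)
  qed
qed

lemma rcong_one: "(rcong {\<one>}) = Id_on (carrier G)"
proof -
  have "y = x" if "x \<in> carrier G" "y \<in> carrier G" "inv x \<otimes> y = \<one>" for x y
    using that inv_unique' by (metis inv_closed inv_equality inv_inv)
  then show ?thesis by (auto simp: r_congruent_def Id_on_def)
qed

lemma rcong_carrier: "(rcong (carrier G)) = carrier G \<times> carrier G"
  by (auto simp: r_congruent_def)

text \<open>A subgroup is recovered from its coset relation, so \<open>rcong\<close> is injective on
  subgroups.\<close>

lemma rcong_Image_one:
  assumes "subgroup H G"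
  shows "(rcong H) `` {\<one>} = H"
  using subgroup.subset[OF assms] by (auto simp: r_congruent_def)

end

section \<open>The derived operation and its skew elements\<close>

locale nary_der = group G for G (structure) +
  fixes \<theta> :: "'a \<Rightarrow> 'a" and b :: 'a and n :: nat
  assumes n: "n \<ge> 2"
    and \<theta>: "\<theta> \<in> hom G G"
    and b: "b \<in> carrier G"
    and \<theta>_power: "x \<in> carrier G \<Longrightarrow> (\<theta> ^^ (n - 1)) x = b \<otimes> x \<otimes> inv b"
begin

lemma funpow_closed: "x \<in> carrier G \<Longrightarrow> (\<theta> ^^ i) x \<in> carrier G"
  using \<theta> by (induction i) (auto simp: hom_def)

lemma funpow_one: "(\<theta> ^^ i) \<one> = \<one>"
  using hom_one[OF \<theta> is_group is_group] by (induction i) auto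

text \<open>As \<open>\<theta> ^^ (n - 1)\<close> is conjugation by \<open>b\<close>, the last
  factor followed by \<open>b\<close> collapses to \<open>b \<otimes> z\<close>. The last argument
  thus enters without any power of \<open>\<theta>\<close>, which makes equations for it solvable by
  cancellation.\<close>

lemma der_op_append:
  assumes "length xs = n - 1" "set xs \<subseteq> carrier G" "z \<in> carrier G"
  shows "der_op G n \<theta> b (xs @ [z]) =
    foldr (\<otimes>) (map (\<lambda>i. (\<theta> ^^ i) (xs ! i)) [0..<n - 1]) (b \<otimes> z)"
proof -
  have "[0..<n] = [0..<n - 1] @ [n - 1]"
    using n upt_Suc_append[of 0 "n - 1"] by simp
  moreover have "(\<theta> ^^ (n - 1)) z \<otimes> b = b \<otimes> z"
    using assms(3) b \<theta>_power[OF assms(3)] by (simp add: m_assoc del: One_nat_def)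
  moreover have "map (\<lambda>i. (\<theta> ^^ i) ((xs @ [z]) ! i)) [0..<n - 1] =
      map (\<lambda>i. (\<theta> ^^ i) (xs ! i)) [0..<n - 1]"
    using assms(1) by (intro map_cong) (auto simp: nth_append)
  moreover have "(xs @ [z]) ! (n - 1) = z" using assms(1) by (simp add: nth_append)
  ultimately show ?thesis
    by (simp only: der_op_def map_append list.map foldr_append foldr.simps o_apply id_apply)
qed

lemma der_op_ends:
  assumes "x \<in> carrier G" "z \<in> carrier G"
  shows "der_op G n \<theta> b (x # replicate (n - 2) \<one> @ [z]) = x \<otimes> b \<otimes> z"
proof -
  have "der_op G n \<theta> b ((x # replicate (n - 2) \<one>) @ [z]) =
    foldr (\<otimes>) (map (\<lambda>i. (\<theta> ^^ i) ((x # replicate (n - 2) \<one>) ! i)) [0..<n - 1]) (b \<otimes> z)"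
    using assms n by (intro der_op_append) auto
  \<comment> \<open>Since \<open>n \<ge> 2\<close>, this range is nonempty and \<open>x\<close> can
    be split off; all remaining entries are \<open>\<one>\<close>, fixed by every power of
    \<open>\<theta>\<close>.\<close>
  also have "[0..<n - 1] = 0 # [1..<n - 1]" using n by (simp add: upt_conv_Cons)
  also have "foldr (\<otimes>) (map (\<lambda>i. (\<theta> ^^ i) ((x # replicate (n - 2) \<one>) ! i)) (0 # [1..<n - 1])) (b \<otimes> z)
      = x \<otimes> foldr (\<otimes>) (map (\<lambda>i. (\<theta> ^^ i) ((x # replicate (n - 2) \<one>) ! i)) [1..<n - 1]) (b \<otimes> z)"
    by simp
  also have "foldr (\<otimes>) (map (\<lambda>i. (\<theta> ^^ i) ((x # replicate (n - 2) \<one>) ! i)) [1..<n - 1]) (b \<otimes> z)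
      = b \<otimes> z"
    using assms b by (intro foldr_mult_ones) (auto simp: funpow_one nth_Cons')
  finally show ?thesis using assms b by (simp add: m_assoc)
qed

text \<open>Isolates \<open>\<theta>\<close> inside the operation. For \<open>n = 2\<close> there is
  no padding and \<open>x\<close> is the last argument.\<close>

lemma der_op_second:
  assumes "x \<in> carrier G"
  shows "der_op G n \<theta> b (\<one> # x # replicate (n - 2) \<one>) = \<theta> x \<otimes> b"
proof -
  have "\<theta> x \<in> carrier G" using funpow_closed[of x 1] assms by simp
  moreover have "[0..<n] = 0 # 1 # [2..<n]" using n by (simp add: upt_conv_Cons numeral_2_eq_2)
  moreover have "foldr (\<otimes>) (map (\<lambda>i. (\<theta> ^^ i) ((\<one> # x # replicate (n - 2) \<one>) ! i)) [2..<n]) b = b"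
    using b by (intro foldr_mult_ones) (auto simp: funpow_one nth_Cons')
  ultimately show ?thesis using b by (simp add: der_op_def)
qed

text \<open>The defining equation reads \<open>p \<otimes> y = x\<close> with \<open>p\<close>
  independent of \<open>y\<close>, so it has exactly one solution. The resulting formula uses only
  products, inverses and powers of \<open>\<theta>\<close>, all compatible with the coset relation
  of an invariant normal subgroup.\<close>

lemma skew_der_op:
  assumes x: "x \<in> carrier G"
  shows "skew (carrier G) n (der_op G n \<theta> b) x =
    inv (foldr (\<otimes>) (map (\<lambda>i. (\<theta> ^^ i) x) [0..<n - 1]) b) \<otimes> x"
proof -
  define p where "p = foldr (\<otimes>) (map (\<lambda>i. (\<theta> ^^ i) x) [0..<n - 1]) b"
  have powers: "set (map (\<lambda>i. (\<theta> ^^ i) x) [0..<n - 1]) \<subseteq> carrier G"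
    using funpow_closed[OF x] by auto
  then have p: "p \<in> carrier G" using foldr_mult_closed b by (simp add: p_def)
  have "der_op G n \<theta> b (replicate (n - 1) x @ [y]) = p \<otimes> y" if y: "y \<in> carrier G" for y
  proof -
    have "der_op G n \<theta> b (replicate (n - 1) x @ [y]) =
        foldr (\<otimes>) (map (\<lambda>i. (\<theta> ^^ i) (replicate (n - 1) x ! i)) [0..<n - 1]) (b \<otimes> y)"
      using x y by (intro der_op_append) auto
    also have "map (\<lambda>i. (\<theta> ^^ i) (replicate (n - 1) x ! i)) [0..<n - 1] =
        map (\<lambda>i. (\<theta> ^^ i) x) [0..<n - 1]" by simp
    also have "foldr (\<otimes>) \<dots> (b \<otimes> y) = p \<otimes> y"
      using powers b y foldr_mult_eq_mult[OF powers, of "b \<otimes> y"] foldr_mult_eq_mult[OF powers b]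
        foldr_mult_closed[OF powers one_closed]
      by (simp add: p_def m_assoc)
    finally show ?thesis .
  qed
  then have "skew (carrier G) n (der_op G n \<theta> b) x = (THE y. y \<in> carrier G \<and> p \<otimes> y = x)"
    unfolding skew_def by (intro arg_cong[where f = The]) auto
  also have "\<dots> = inv p \<otimes> x"
    using p x by (intro the_equality) (auto simp flip: m_assoc)
  finally show ?thesis by (simp add: p_def)
qed

section \<open>Congruences and invariant normal subgroups\<close>

lemma nary_congruence_rcong:
  assumes H: "H \<lhd> G" "\<theta> ` H \<subseteq> H"
  shows "nary_congruence (carrier G) n (der_op G n \<theta> b) (rcong H)"
proof -
  interpret H: normal H G by fact
  have carr: "x \<in> carrier G" if "(x, y) \<in> rcong H" for x y
    using that by (simp add: r_congruent_def)
  have refl: "(b, b) \<in> rcong H" using b by (simp add: r_congruent_def)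
  have sym: "(y, x) \<in> rcong H" if "(x, y) \<in> rcong H" for x y
    using H.equiv_rcong[OF is_group] that by (auto simp: equiv_def dest: symD)
  have "(\<theta> x, \<theta> y) \<in> rcong H" if "(x, y) \<in> rcong H" for x y
  proof -
    have "\<theta> (inv x \<otimes> y) = inv (\<theta> x) \<otimes> \<theta> y"
      using that \<theta> group_hom.hom_inv[of G G \<theta> x]
      by (simp add: r_congruent_def hom_mult group_hom_def group_hom_axioms_def is_group)
    then show ?thesis using that H(2) \<theta> by (auto simp: r_congruent_def hom_def)
  qed
  then have power: "((\<theta> ^^ i) x, (\<theta> ^^ i) y) \<in> rcong H" if "(x, y) \<in> rcong H" for x y i
    using that by (induction i) auto
  note foldr = foldr_mult_list_all2[OF rcong_mult[OF H(1)] _ refl]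
  have "(der_op G n \<theta> b xs, der_op G n \<theta> b ys) \<in> rcong H"
    if "\<forall>i<n. (xs ! i, ys ! i) \<in> rcong H" for xs ys
    unfolding der_op_def using that by (intro foldr) (auto simp: list_all2_conv_all_nth power)
  moreover have "(skew (carrier G) n (der_op G n \<theta> b) x, skew (carrier G) n (der_op G n \<theta> b) y)
      \<in> rcong H" if xy: "(x, y) \<in> rcong H" for x y
  proof -
    have "(foldr (\<otimes>) (map (\<lambda>i. (\<theta> ^^ i) x) [0..<n - 1]) b,
        foldr (\<otimes>) (map (\<lambda>i. (\<theta> ^^ i) y) [0..<n - 1]) b) \<in> rcong H"
      using xy by (intro foldr) (auto simp: list_all2_conv_all_nth power)
    then show ?thesis
      using xy carr[OF xy] carr[OF sym[OF xy]] H(1)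
      by (simp add: skew_der_op rcong_mult rcong_inv)
  qed
  ultimately show ?thesis
    using H.equiv_rcong[OF is_group] by (auto simp: nary_congruence_def)
qed

text \<open>The witness is the class of \<open>\<one>\<close>; translations are recovered from the
  two ends of the operation, and \<open>\<theta>\<close> from its second argument.\<close>

lemma nary_congruence_imp_rcong:
  assumes "nary_congruence (carrier G) n (der_op G n \<theta> b) R"
  obtains H where "H \<lhd> G" "\<theta> ` H \<subseteq> H" "R = rcong H"
proof
  have eq: "equiv (carrier G) R"
    and op: "\<And>xs ys. length xs = n \<Longrightarrow> list_all2 (\<lambda>x y. (x, y) \<in> R) xs ys \<Longrightarrow>
      (der_op G n \<theta> b xs, der_op G n \<theta> b ys) \<in> R"
    using assms by (auto simp: nary_congruence_def list_all2_conv_all_nth)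
  have carr: "x \<in> carrier G" "y \<in> carrier G" if "(x, y) \<in> R" for x y
    using eq that by (auto simp: equiv_def)
  have refl: "(x, x) \<in> R" if "x \<in> carrier G" for x
    using eq that by (auto simp: equiv_def refl_on_def)
  have ones: "list_all2 (\<lambda>x y. (x, y) \<in> R) (replicate k \<one>) (replicate k \<one>)" for k
    using refl by (simp add: list_all2_conv_all_nth)
  have ends: "(x \<otimes> b \<otimes> u, y \<otimes> b \<otimes> v) \<in> R" if "(x, y) \<in> R" "(u, v) \<in> R" for x y u v
    using op[of "x # replicate (n - 2) \<one> @ [u]" "y # replicate (n - 2) \<one> @ [v]"] that n
    by (simp add: der_op_ends carr[OF that(1)] carr[OF that(2)] ones list_all2_appendI)
  \<comment> \<open>The first argument \<open>g \<otimes> inv b\<close> cancels the \<open>b\<close>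
    in the middle; the right translation uses \<open>inv b \<otimes> g\<close> as last
    argument.\<close>
  have left: "(g \<otimes> x, g \<otimes> y) \<in> R" if "g \<in> carrier G" "(x, y) \<in> R" for g x y
    using ends[OF refl that(2), of "g \<otimes> inv b"] that(1) b by (simp add: m_assoc)
  have right: "(x \<otimes> g, y \<otimes> g) \<in> R" if "g \<in> carrier G" "(x, y) \<in> R" for g x y
    using ends[OF that(2) refl, of "inv b \<otimes> g"] that(1) b carr[OF that(2)]
    by (simp add: m_assoc flip: m_assoc[of b "inv b"])
  show "R `` {\<one>} \<lhd> G" "R = rcong (R `` {\<one>})"
    using normal_of_translation_invariant[OF eq left right] by auto
  show "\<theta> ` (R `` {\<one>}) \<subseteq> R `` {\<one>}"
  proof clarsimp
    fix x assume x: "(\<one>, x) \<in> R"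
    have \<theta>x: "\<theta> x \<in> carrier G" using funpow_closed[of x 1] carr[OF x] by simp
    \<comment> \<open>Only the second argument varies, from \<open>\<one>\<close> to
      \<open>x\<close>; right translation by \<open>inv b\<close> then removes the factor
      \<open>b\<close>.\<close>
    have "(\<theta> \<one> \<otimes> b, \<theta> x \<otimes> b) \<in> R"
      using op[of "\<one> # \<one> # replicate (n - 2) \<one>" "\<one> # x # replicate (n - 2) \<one>"] x n
      by (simp add: der_op_second carr[OF x] ones refl)
    from right[OF inv_closed[OF b] this] show "(\<one>, \<theta> x) \<in> R"
      using b \<theta>x funpow_one[of 1] by (simp add: m_assoc)
  qed
qed

theorem UAS_iff:
  "UAS (carrier G) n (der_op G n \<theta> b) \<longleftrightarrow>
    (\<forall>H. H \<lhd> G \<and> \<theta> ` H \<subseteq> H \<longrightarrow> H = {\<one>} \<or> H = carrier G)"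
proof
  assume uas: "UAS (carrier G) n (der_op G n \<theta> b)"
  show "\<forall>H. H \<lhd> G \<and> \<theta> ` H \<subseteq> H \<longrightarrow> H = {\<one>} \<or> H = carrier G"
  proof clarify
    fix H assume H: "H \<lhd> G" "\<theta> ` H \<subseteq> H" and ne: "H \<noteq> carrier G"
    \<comment> \<open>Writing both trivial relations as coset relations lets the classes of
      \<open>\<one>\<close> be compared, which turns equal relations into equal subgroups.\<close>
    have "(rcong H) = (rcong {\<one>}) \<or> (rcong H) = (rcong (carrier G))"
      using uas nary_congruence_rcong[OF H] by (simp add: UAS_def rcong_one rcong_carrier)
    then show "H = {\<one>}"
      using ne H(1) rcong_Image_one triv_subgroup subgroup_self normal_imp_subgroup by metis
  qed
next
  assume "\<forall>H. H \<lhd> G \<and> \<theta> ` H \<subseteq> H \<longrightarrow> H = {\<one>} \<or> H = carrier G"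
  then show "UAS (carrier G) n (der_op G n \<theta> b)"
    unfolding UAS_def by (metis nary_congruence_imp_rcong rcong_one rcong_carrier)
qed

end

theorem theorem3p3:
  fixes G :: "('a, 'm) monoid_scheme" (structure)
    and \<theta> :: "'a \<Rightarrow> 'a" and b :: 'a and n :: nat
  assumes "group G"
    and "n \<ge> 2"
    and "\<theta> \<in> iso G G"
    and "b \<in> carrier G"
    and "\<theta> b = b"
    and "\<And>x. x \<in> carrier G \<Longrightarrow> (\<theta> ^^ (n - 1)) x = b \<otimes> x \<otimes> inv b"
  shows "UAS (carrier G) n (der_op G n \<theta> b) \<longleftrightarrow>
    (\<forall>H. H \<lhd> G \<and> \<theta> ` H \<subseteq> H \<longrightarrow> H = {\<one>} \<or> H = carrier G)"
proof -
  interpret group G by fact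
  interpret nary_der G \<theta> b n
    using assms by unfold_locales (auto simp: iso_def)
  show ?thesis by (rule UAS_iff)
qed

end
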